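(* Let $\Omega\subset\mathbb{R}^n$ be a bounded extension domain for $W^{s,p}$ and let $V\in L^q(\Omega)$ with $q\in(1,\infty)\cap(\tfrac{n}{sp},\infty)$. If $u$ is a nonnegative eigenfunction associated to an eigenvalue $\lambda\in\mathbb{R}$ (for the potential $V$), then $u>0$ a.e. in $\Omega$.
   Context: Fix $n\ge 1$, $0<s<1<p<\infty$. For an open set $\Omega\subset\mathbb{R}^n$, $W^{s,p}(\Omega)$ is the space of $u\in L^p(\Omega)$ with $[u]_{s,p;\Omega}:=\left(\iint_{\Omega\times\Omega}\frac{|u(x)-u(y)|^p}{|x-y|^{n+sp}}\,dx\,dy\right)^{1/p}<\infty$, normed by $\|u\|_{s,p;\Omega}=(\|u\|_{L^p(\Omega)}^p+[u]_{s,p;\Omega}^p)^{1/p}$; $\|u\|_{s,p}$ denotes this norm for $\Omega=\mathbb{R}^n$. An open set $\Omega$ is an extension domain for $W^{s,p}$ if there is $C=C(n,s,p,\Omega)>0$ such that every $u\in W^{s,p}(\Omega)$ has an extension $\tilde u\in W^{s,p}(\mathbb{R}^n)$ with $\tilde u=u$ on $\Omega$ and $\|\tilde u\|_{s,p}\le C\|u\|_{s,p;\Omega}$. $\widetilde W^{s,p}(\Omega)$ is the space of all $u\in W^{s,p}(\Omega)$ whose extension by zero outside $\Omega$ belongs to $W^{s,p}(\mathbb{R}^n)$, normed by the $W^{s,p}(\mathbb{R}^n)$ norm of the zero extension; such $u$ are always identified with their zero extension to $\mathbb{R}^n$. For $u,v\in W^{s,p}(\mathbb{R}^n)$ put $\mathcal{H}(u,v)=\frac12\iint_{\mathbb{R}^n\times\mathbb{R}^n}\frac{|u(x)-u(y)|^{p-2}(u(x)-u(y))(v(x)-v(y))}{|x-y|^{n+sp}}\,dx\,dy$.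 A number $\lambda\in\mathbb{R}$ is an eigenvalue (for the potential $V$) if there is a nontrivial $u\in\widetilde W^{s,p}(\Omega)$ (an eigenfunction associated to $\lambda$) with $\mathcal{H}(u,v)+\int_\Omega V|u|^{p-2}uv\,dx=\lambda\int_{\mathbb{R}^n}|u|^{p-2}uv\,dx$ for all $v\in\widetilde W^{s,p}(\Omega)$. *)

theory Defs
  imports "HOL-Analysis.Analysis"
begin

text \<open>
  Elements of \<open>L\<^sup>p(\<Omega>)\<close> and \<open>W\<^sup>s\<^sup>,\<^sup>p(\<Omega>)\<close> are represented by functions on the whole
  space of which only the restriction to \<open>\<Omega>\<close> matters; everything below is invariant under changes
  on null sets. Double integrals are taken over the product of two copies of Lebesgue measure.
\<close>

definition Lp_space :: "real \<Rightarrow> 'a::euclidean_space set \<Rightarrow> ('a \<Rightarrow> real) set"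
  where "Lp_space p \<Omega> = {u. set_borel_measurable lebesgue \<Omega> u
                           \<and> set_integrable lebesgue \<Omega> (\<lambda>x. \<bar>u x\<bar> powr p)}"

definition gagliardo_integrand ::
    "real \<Rightarrow> real \<Rightarrow> (real^'n \<Rightarrow> real) \<Rightarrow> (real^'n) \<times> (real^'n) \<Rightarrow> real"
  where "gagliardo_integrand s p u =
    (\<lambda>(x, y). \<bar>u x - u y\<bar> powr p / norm (x - y) powr (real CARD('n) + s * p))"

text \<open>
  The integrand is nonnegative, and measurable on \<open>\<Omega> \<times> \<Omega>\<close> for measurable \<open>u\<close>, so integrability
  says exactly that the seminorm is finite.
\<close>

definition Wsp :: "real \<Rightarrow> real \<Rightarrow> (real^'n) set \<Rightarrow> (real^'n \<Rightarrow> real) set"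
  where "Wsp s p \<Omega> = {u. u \<in> Lp_space p \<Omega> \<and>
    set_integrable (lebesgue \<Otimes>\<^sub>M lebesgue) (\<Omega> \<times> \<Omega>) (gagliardo_integrand s p u)}"

definition Lp_norm :: "real \<Rightarrow> 'a::euclidean_space set \<Rightarrow> ('a \<Rightarrow> real) \<Rightarrow> real"
  where "Lp_norm p \<Omega> u = (set_lebesgue_integral lebesgue \<Omega> (\<lambda>x. \<bar>u x\<bar> powr p)) powr (1 / p)"

definition gagliardo_seminorm :: "real \<Rightarrow> real \<Rightarrow> (real^'n) set \<Rightarrow> (real^'n \<Rightarrow> real) \<Rightarrow> real"
  where "gagliardo_seminorm s p \<Omega> u =
    (set_lebesgue_integral (lebesgue \<Otimes>\<^sub>M lebesgue) (\<Omega> \<times> \<Omega>) (gagliardo_integrand s p u)) powr (1 / p)"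

definition Wsp_norm :: "real \<Rightarrow> real \<Rightarrow> (real^'n) set \<Rightarrow> (real^'n \<Rightarrow> real) \<Rightarrow> real"
  where "Wsp_norm s p \<Omega> u =
    (Lp_norm p \<Omega> u powr p + gagliardo_seminorm s p \<Omega> u powr p) powr (1 / p)"

text \<open>No connectedness is required of an extension domain.\<close>

definition extension_domain :: "real \<Rightarrow> real \<Rightarrow> (real^'n) set \<Rightarrow> bool"
  where "extension_domain s p \<Omega> \<longleftrightarrow> open \<Omega> \<and>
    (\<exists>C>0. \<forall>u\<in>Wsp s p \<Omega>. \<exists>w\<in>Wsp s p UNIV.
       (AE x in lebesgue. x \<in> \<Omega> \<longrightarrow> w x = u x) \<and> Wsp_norm s p UNIV w \<le> C * Wsp_norm s p \<Omega> u)"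

definition zero_ext :: "'a set \<Rightarrow> ('a \<Rightarrow> real) \<Rightarrow> 'a \<Rightarrow> real"
  where "zero_ext \<Omega> u = (\<lambda>x. if x \<in> \<Omega> then u x else 0)"

definition Wsp_tilde :: "real \<Rightarrow> real \<Rightarrow> (real^'n) set \<Rightarrow> (real^'n \<Rightarrow> real) set"
  where "Wsp_tilde s p \<Omega> = {u \<in> Wsp s p \<Omega>. zero_ext \<Omega> u \<in> Wsp s p UNIV}"

text \<open>
  The map \<open>t \<mapsto> |t|\<^sup>p\<^sup>-\<^sup>2 t\<close>, with value 0 at \<open>t = 0\<close> also when \<open>p < 2\<close>.
\<close>

definition signed_pow :: "real \<Rightarrow> real \<Rightarrow> real"
  where "signed_pow p t = \<bar>t\<bar> powr (p - 2) * t"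

definition frac_form :: "real \<Rightarrow> real \<Rightarrow> (real^'n \<Rightarrow> real) \<Rightarrow> (real^'n \<Rightarrow> real) \<Rightarrow> real"
  where "frac_form s p u v = 1 / 2 *
    integral\<^sup>L (lebesgue \<Otimes>\<^sub>M lebesgue)
      (\<lambda>(x, y). signed_pow p (u x - u y) * (v x - v y) / norm (x - y) powr (real CARD('n) + s * p))"

text \<open>
  Nontriviality is meant for the class of \<open>u\<close> modulo null sets.
\<close>

definition eigenfunction ::
    "real \<Rightarrow> real \<Rightarrow> (real^'n) set \<Rightarrow> (real^'n \<Rightarrow> real) \<Rightarrow> real \<Rightarrow> (real^'n \<Rightarrow> real) \<Rightarrow> bool"
  where "eigenfunction s p \<Omega> V ev u \<longleftrightarrow>
    u \<in> Wsp_tilde s p \<Omega> \<and> \<not> (AE x in lebesgue. x \<in> \<Omega> \<longrightarrow> u x = 0) \<and>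
    (\<forall>v\<in>Wsp_tilde s p \<Omega>.
       frac_form s p (zero_ext \<Omega> u) (zero_ext \<Omega> v)
         + set_lebesgue_integral lebesgue \<Omega> (\<lambda>x. V x * signed_pow p (u x) * v x)
       = ev * integral\<^sup>L lebesgue (\<lambda>x. signed_pow p (zero_ext \<Omega> u x) * zero_ext \<Omega> v x))"

definition eigenvalue :: "real \<Rightarrow> real \<Rightarrow> (real^'n) set \<Rightarrow> (real^'n \<Rightarrow> real) \<Rightarrow> real \<Rightarrow> bool"
  where "eigenvalue s p \<Omega> V ev \<longleftrightarrow> (\<exists>u. eigenfunction s p \<Omega> V ev u)"

end

theory Submission
  imports Defs
begin

text \<open>
  The proof is purely nonlocal: at a zero of a nonnegative function \<open>w\<close> the operator attached to the
  form is, formally, \<open>- \<integral> w(y)\<^sup>p\<^sup>-\<^sup>1 |x - y|\<^sup>-\<^sup>n\<^sup>-\<^sup>s\<^sup>p dy\<close>, which is negative unless \<open>w\<close> vanishes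
  almost everywhere, whereas the zero-order terms of the equation vanish there. To make this
  rigorous, let \<open>w\<close> be the zero extension of the eigenfunction and test with
  \<open>v\<^sub>k = \<phi> g\<^sub>k(w)\<close>, where \<open>g\<^sub>k(t) = max(0, 1 - (k + 1) t)\<close> for \<open>t \<ge> 0\<close> concentrates on the zero set
  of \<open>w\<close>, and \<open>\<phi> = min(1, dist(x, complement of \<Omega>))\<close> is positive exactly on \<open>\<Omega>\<close>.

  \<^item> Where \<open>v\<^sub>k\<close> does not vanish one has \<open>w < 1 / (k + 1)\<close>, so that \<open>w\<^sup>p\<^sup>-\<^sup>1 v\<^sub>k\<close> is bounded by 1 and
    tends to 0 pointwise; as \<open>V\<close> is integrable on \<open>\<Omega>\<close>, both zero-order terms tend to 0
    (\<open>lower_order_term_tendsto_0\<close>). Hence the form evaluated at \<open>(w, v\<^sub>k)\<close> tends to 0.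

  \<^item> The integrand of the form splits as \<open>A\<^sub>k + B\<^sub>k\<close>. Here \<open>A\<^sub>k \<le> 0\<close> collects the
    differences of \<open>g\<^sub>k(w)\<close>, with \<open>\<phi>\<close> taken at the point where \<open>w\<close> is smaller, and \<open>B\<^sub>k\<close> those of
    \<open>\<phi>\<close>, with \<open>g\<^sub>k\<close> taken at the larger value of \<open>w\<close>. Since \<open>B\<^sub>k\<close> tends to 0 pointwise and is
    dominated, its integral tends to 0, and therefore so does that of \<open>A\<^sub>k\<close>. At pairs \<open>(x, y)\<close>
    with \<open>w(x) = 0\<close> and \<open>w(y) \<ge> 1 / (k + 1)\<close>, however,
    \<open>A\<^sub>k = - w(y)\<^sup>p\<^sup>-\<^sup>1 \<phi>(x) |x - y|\<^sup>-\<^sup>n\<^sup>-\<^sup>s\<^sup>p\<close>. So almost no pair has \<open>\<phi>(x) > 0\<close>, \<open>w(x) = 0\<close> and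
    \<open>w(y) > 0\<close> (\<open>AE_no_pair_of_zero_and_positive_point\<close>).

  Consequently the product of \<open>{w = 0} \<inter> \<Omega>\<close> and \<open>{w > 0}\<close> is a null set; the second factor has positive
  measure, so the first is null. The interaction of distant points replaces any connectedness of
  \<open>\<Omega>\<close>. What remains is that \<open>\<phi>\<close>, and with it \<open>v\<^sub>k\<close>, is an admissible test function
  (\<open>cutoff_in_Wsp\<close>, \<open>cutoff_mult_Lipschitz_in_Wsp_tilde\<close>); for \<open>\<phi>\<close> this rests on the integrability of
  \<open>min(1, |h|)\<^sup>p |h|\<^sup>-\<^sup>n\<^sup>-\<^sup>s\<^sup>p\<close>.
\<close>

section \<open>Integrability of truncated singular kernels\<close>

lemma powr_dyadic_exists: assumes "1 \<le> (x::real)" shows "\<exists>k::nat. 2^k \<le> x \<and> x \<le> 2^(k+1)"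
proof -
  have "0 \<le> log 2 x" using assms by simp
  define k where "k = nat \<lfloor>log 2 x\<rfloor>"
  have k: "real k \<le> log 2 x" "log 2 x \<le> real (k+1)"
    using \<open>0 \<le> log 2 x\<close> by (auto simp: k_def) linarith+
  have "2 powr real k \<le> x" using k assms by (simp add: le_log_iff)
  moreover have "x \<le> 2 powr real (k+1)" using k(2) assms by (subst (asm) log_le_iff) auto
  ultimately show ?thesis by (auto simp only: powr_realpow)
qed

text \<open>
  Each point of \<open>E\<close> lies in a ball of some radius \<open>r k\<close>, and \<open>f\<close> is there at most a geometric term
  divided by the volume scale of that ball; summing over all balls gives a geometric series.
\<close>

lemma nn_integral_dyadic_finite:
  fixes f :: "'a::euclidean_space \<Rightarrow> real"
  assumes \<theta>: "0 < \<theta>" "\<theta> < 1" and "0 \<le> C" and r: "\<And>k::nat. 0 < r k"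
    and bd: "\<And>h. h \<in> E \<Longrightarrow> \<exists>k. norm h \<le> r k \<and> f h \<le> C * \<theta> ^ k / r k ^ DIM('a)"
  shows "(\<integral>\<^sup>+h. ennreal (f h) * indicator E h \<partial>lborel) < \<infinity>"
proof -
  define m where "m k = C * \<theta> ^ k / r k ^ DIM('a)" for k
  have m0: "0 \<le> m k" for k unfolding m_def using assms(3) \<theta> r[of k] by simp
  define V where "V = unit_ball_vol (real DIM('a))"
  have V: "0 \<le> V" by (simp add: V_def)
  have "ennreal (f h) * indicator E h \<le> (\<Sum>k. ennreal (m k) * indicator (cball 0 (r k)) h)" for h
  proof (cases "h \<in> E")
    case True
    then obtain k where k: "norm h \<le> r k" "f h \<le> m k" using bd unfolding m_def by blast
    have "ennreal (f h) * indicator E h \<le> ennreal (m k) * indicator (cball 0 (r k)) h"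
      using k True by (auto intro: ennreal_leI)
    also have "\<dots> \<le> (\<Sum>k. ennreal (m k) * indicator (cball 0 (r k)) h)"
    proof -
      define F where "F k = ennreal (m k) * indicator (cball 0 (r k)) h" for k
      have "sum F {k} \<le> suminf F" by (rule sum_le_suminf) auto
      then show ?thesis by (simp add: F_def[abs_def, symmetric] F_def[symmetric])
    qed
    finally show ?thesis .
  qed simp
  moreover have [measurable]: "cball (0::'a) (r k) \<in> sets borel" for k by auto
  ultimately have "(\<integral>\<^sup>+h. ennreal (f h) * indicator E h \<partial>lborel)
      \<le> (\<integral>\<^sup>+h. (\<Sum>k. ennreal (m k) * indicator (cball 0 (r k)) (h::'a)) \<partial>lborel)"
    by (intro nn_integral_mono)
  also have "\<dots> = (\<Sum>k. \<integral>\<^sup>+h. ennreal (m k) * indicator (cball 0 (r k)) (h::'a) \<partial>lborel)"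
    by (rule nn_integral_suminf) measurable
  also have "\<dots> = (\<Sum>k. ennreal (C * V * \<theta> ^ k))"
  proof (rule suminf_cong)
    fix k
    have "(\<integral>\<^sup>+h. ennreal (m k) * indicator (cball 0 (r k)) (h::'a) \<partial>lborel) = ennreal (m k) * ennreal (V * r k ^ DIM('a))"
      using r[of k] by (simp add: nn_integral_cmult_indicator emeasure_cball V_def)
    also have "\<dots> = ennreal (m k * (V * r k ^ DIM('a)))"
      using m0 V r[of k] by (simp add: ennreal_mult)
    also have "m k * (V * r k ^ DIM('a)) = C * V * \<theta> ^ k" using r[of k] by (simp add: m_def)
    finally show "(\<integral>\<^sup>+h. ennreal (m k) * indicator (cball 0 (r k)) (h::'a) \<partial>lborel) = ennreal (C * V * \<theta> ^ k)" .
  qed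
  also have "\<dots> < \<infinity>"
  proof -
    have "summable (\<lambda>k. C * V * \<theta> ^ k)" using \<theta> by (intro summable_mult summable_geometric) auto
    then have "(\<Sum>k. ennreal (C * V * \<theta> ^ k)) = ennreal (\<Sum>k. C * V * \<theta> ^ k)"
      using \<theta> V assms(3) by (intro suminf_ennreal2) auto
    then show ?thesis by simp
  qed
  finally show ?thesis .
qed

lemma nn_integral_truncated_singular_kernel_finite:
  fixes a b :: real
  assumes "0 < a" "0 < b"
  shows "(\<integral>\<^sup>+h. ennreal (min (norm (h::'a::euclidean_space) powr a) (norm h powr (-b)) / norm h powr real DIM('a)) \<partial>lborel) < \<infinity>"
    (is "(\<integral>\<^sup>+h. ennreal (?f h) \<partial>lborel) < \<infinity>")
proof -
  let ?n = "DIM('a)"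
  have in1: "(\<integral>\<^sup>+h. ennreal (?f h) * indicator (cball 0 1) h \<partial>lborel) < \<infinity>"
  proof (rule nn_integral_dyadic_finite[where \<theta> = "2 powr (-a)" and C = "2 ^ ?n" and r = "\<lambda>k. 1 / 2 ^ k"])
    show "2 powr - a < 1" using powr_less_mono[of "-a" 0 2] assms by simp
    fix h :: 'a assume "h \<in> cball 0 1"
    show "\<exists>k. norm h \<le> 1 / 2 ^ k \<and> ?f h \<le> 2 ^ ?n * (2 powr - a) ^ k / (1 / 2 ^ k) ^ ?n"
    proof (cases "h = 0")
      case True then show ?thesis by (intro exI[of _ 0]) auto
    next
      case False
      then have t: "0 < norm h" "norm h \<le> 1" using \<open>h \<in> _\<close> by auto
      obtain k where k: "2^k \<le> 1 / norm h" "1 / norm h \<le> 2^(k+1)"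
        using powr_dyadic_exists[of "1 / norm h"] t by auto
      have k1: "norm h \<le> 1 / 2^k" using k(1) t by (simp add: field_simps)
      have k2: "1 / 2^(k+1) \<le> norm h" using k(2) t by (simp add: field_simps)
      have "norm h powr a \<le> (1/2^k) powr a" using k1 t assms by (intro powr_mono2) auto
      also have "(1/2^k) powr a = (2 powr -a) ^ k"
        by (simp add: powr_divide powr_minus powr_powr powr_realpow[symmetric] field_simps)
      finally have A: "norm h powr a \<le> (2 powr -a) ^ k" .
      have B: "(1 / 2^(k+1)) ^ ?n \<le> norm h powr real ?n"
        using k2 t by (simp add: powr_realpow power_mono)
      have "?f h \<le> (2 powr -a) ^ k / (1 / 2^(k+1)) ^ ?n"
        using A B by (intro frac_le) auto
      also have "\<dots> = 2 ^ ?n * (2 powr - a) ^ k / (1 / 2 ^ k) ^ ?n"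
        by (simp add: field_simps power_mult_distrib power_divide)
      finally show ?thesis using k1 by blast
    qed
  qed auto
  have in2: "(\<integral>\<^sup>+h. ennreal (?f h) * indicator (- ball 0 1) h \<partial>lborel) < \<infinity>"
  proof (rule nn_integral_dyadic_finite[where \<theta> = "2 powr (-b)" and C = "2 ^ ?n" and r = "\<lambda>k. 2 ^ (k+1)"])
    show "2 powr - b < 1" using powr_less_mono[of "-b" 0 2] assms by simp
    fix h :: 'a assume "h \<in> - ball 0 1"
    then have t: "1 \<le> norm h" by auto
    obtain k where k: "2^k \<le> norm h" "norm h \<le> 2^(k+1)"
      using powr_dyadic_exists[OF t] by auto
    have "norm h powr (-b) \<le> (2^k) powr (-b)" using k assms by (intro powr_mono2') auto
    also have "(2^k) powr (-b) = (2 powr -b) ^ k"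
      by (simp add: powr_powr powr_realpow[symmetric] field_simps)
    finally have A: "norm h powr (-b) \<le> (2 powr -b) ^ k" .
    have B: "(2^k) ^ ?n \<le> norm h powr real ?n"
      using k t by (subst powr_realpow) (auto intro: power_mono)
    have "?f h \<le> (2 powr -b) ^ k / (2^k) ^ ?n"
      using A B by (intro frac_le) auto
    also have "\<dots> = 2 ^ ?n * (2 powr - b) ^ k / (2 ^ (k+1)) ^ ?n"
      by (simp add: field_simps power_mult_distrib)
    finally show "\<exists>k. norm h \<le> 2^(k+1) \<and> ?f h \<le> 2 ^ ?n * (2 powr - b) ^ k / (2 ^ (k+1)) ^ ?n"
      using k by blast
  qed auto
  have [measurable]: "cball (0::'a) 1 \<in> sets borel" "- ball (0::'a) 1 \<in> sets borel" by auto
  have "(\<integral>\<^sup>+h. ennreal (?f h) \<partial>lborel)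
      \<le> (\<integral>\<^sup>+h. ennreal (?f h) * indicator (cball 0 1) h + ennreal (?f h) * indicator (- ball 0 1) h \<partial>lborel)"
    by (intro nn_integral_mono) (auto simp: indicator_def)
  also have "\<dots> = (\<integral>\<^sup>+h. ennreal (?f h) * indicator (cball 0 1) h \<partial>lborel)
      + (\<integral>\<^sup>+h. ennreal (?f h) * indicator (- ball 0 1) h \<partial>lborel)"
    by (rule nn_integral_add) measurable
  also have "\<dots> < \<infinity>" using in1 in2 by simp
  finally show ?thesis .
qed


text \<open>
  The bound for the Gagliardo integrand of a bounded Lipschitz function, in the form treated by
  \<open>nn_integral_truncated_singular_kernel_finite\<close>.
\<close>

lemma min_one_powr_over_kernel_eq:
  fixes s p n t :: real
  assumes "0 < s" "s < 1" "1 < p" and that: "0 \<le> t"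
  shows "min 1 t powr p / t powr (n + s * p) = min (t powr (p - s*p)) (t powr (-(s*p))) / t powr n"
proof (cases "t = 0")
  case True then show ?thesis using assms by simp
next
  case False
  then have t: "t > 0" using that by simp
  have e: "t powr (n + s*p) = t powr n * t powr (s*p)" by (rule powr_add)
  have sp: "s * p < p" "0 < s * p" using assms by auto
  show ?thesis
  proof (cases "t \<le> 1")
    case True
    have "t powr (p - s*p) \<le> t powr (-(s*p))" using t True sp assms by (intro powr_mono') auto
    then have "min (t powr (p - s*p)) (t powr (-(s*p))) = t powr p / t powr (s*p)"
      by (simp add: min_def powr_diff)
    then show ?thesis using True unfolding e by (simp add: mult.commute)
  next
    case False
    then have "t powr (-(s*p)) \<le> t powr (p - s*p)" using t sp assms by (intro powr_mono) auto
    then have "min (t powr (p - s*p)) (t powr (-(s*p))) = 1 / t powr (s*p)"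
      by (simp add: min_def powr_minus_divide)
    then show ?thesis using False unfolding e by (simp add: mult.commute)
  qed
qed

section \<open>The product of two Lebesgue measures\<close>

lemma sigma_finite_lebesgue: "sigma_finite_measure (lebesgue :: 'a::euclidean_space measure)"
proof
  obtain A :: "'a set set" where A: "countable A" "A \<subseteq> sets lborel" "\<Union>A = space lborel"
    "\<forall>a\<in>A. emeasure lborel a \<noteq> \<infinity>"
    using lborel.sigma_finite_countable by blast
  then show "\<exists>A::'a set set. countable A \<and> A \<subseteq> sets lebesgue \<and> \<Union> A = space lebesgue \<and> (\<forall>a\<in>A. emeasure lebesgue a \<noteq> \<infinity>)"
    by (intro exI[of _ A]) (auto simp: subset_eq intro: sets_completionI_sets)
qed

interpretation lebesgue: sigma_finite_measure "lebesgue :: 'a::euclidean_space measure"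
  by (rule sigma_finite_lebesgue)

interpretation lebesgue_pair: pair_sigma_finite "lebesgue :: 'a::euclidean_space measure"
  "lebesgue :: 'b::euclidean_space measure" ..

lemma measurable_ident_lebesgue_borel [measurable]: "(\<lambda>x. x) \<in> lebesgue \<rightarrow>\<^sub>M borel"
  using id_borel_measurable_lebesgue by (simp add: id_def)

lemma measurable_lebesgue_of_borel: "f \<in> borel_measurable borel \<Longrightarrow> f \<in> borel_measurable lebesgue"
  by (simp add: measurable_completion)

lemma measurable_fst_borel [measurable]: "fst \<in> borel_measurable (lebesgue \<Otimes>\<^sub>M M)"
  using measurable_compose[OF measurable_fst measurable_ident_lebesgue_borel] by simp

lemma measurable_snd_borel [measurable]: "snd \<in> borel_measurable (M \<Otimes>\<^sub>M lebesgue)"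
  using measurable_compose[OF measurable_snd measurable_ident_lebesgue_borel] by simp

lemma AE_lebesgue_pair_fst_snd:
  assumes "AE x in lebesgue. P (x::'a::euclidean_space)"
  shows "AE z in lebesgue \<Otimes>\<^sub>M lebesgue. P (fst z) \<and> P (snd z)"
proof -
  obtain N where N: "N \<in> null_sets lebesgue" "{x. \<not> P x} \<subseteq> N"
    using assms unfolding eventually_ae_filter by auto
  have "N \<times> UNIV \<in> null_sets (lebesgue \<Otimes>\<^sub>M lebesgue)"
    using lebesgue.times_in_null_sets1[OF N(1), of UNIV] by simp
  moreover have "UNIV \<times> N \<in> null_sets (lebesgue \<Otimes>\<^sub>M lebesgue)"
    by (rule lebesgue.times_in_null_sets2) (use N(1) in auto)
  ultimately have "N \<times> UNIV \<union> UNIV \<times> N \<in> null_sets (lebesgue \<Otimes>\<^sub>M lebesgue)" by blast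
  then show ?thesis by (rule AE_I') (use N(2) in auto)
qed

lemma nn_integral_lebesgue_translate:
  fixes f :: "'a::euclidean_space \<Rightarrow> ennreal"
  assumes [measurable]: "f \<in> borel_measurable borel"
  shows "(\<integral>\<^sup>+y. f (y + x) \<partial>lebesgue) = (\<integral>\<^sup>+y. f y \<partial>lborel)"
proof -
  have "(\<integral>\<^sup>+y. f y \<partial>lborel) = (\<integral>\<^sup>+y. f y \<partial>distr lborel borel ((+) x))"
    by (simp add: lborel_distr_plus)
  also have "\<dots> = (\<integral>\<^sup>+y. f (x + y) \<partial>lborel)" by (rule nn_integral_distr) auto
  finally show ?thesis by (simp add: nn_integral_completion add.commute)
qed

section \<open>Inequalities for powers\<close>

lemma abs_signed_pow: "\<bar>signed_pow p t\<bar> = \<bar>t\<bar> powr (p - 1)"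
  using powr_mult_base[of "\<bar>t\<bar>" "p-2"] by (simp add: signed_pow_def abs_mult mult.commute)

text \<open>
  A crude form of Young's inequality, which makes the integrand of the form integrable.
\<close>

lemma signed_pow_mult_le:
  assumes "1 < p" shows "\<bar>signed_pow p a * b\<bar> \<le> \<bar>a\<bar> powr p + \<bar>b\<bar> powr p"
proof (cases "\<bar>b\<bar> \<le> \<bar>a\<bar>")
  case True
  have "\<bar>signed_pow p a * b\<bar> = \<bar>a\<bar> powr (p - 1) * \<bar>b\<bar>"
    by (simp add: abs_mult abs_signed_pow)
  also have "\<dots> \<le> \<bar>a\<bar> powr (p - 1) * \<bar>a\<bar>" using True by (intro mult_left_mono) auto
  also have "\<dots> = \<bar>a\<bar> powr p" using powr_mult_base[of "\<bar>a\<bar>" "p-1"] by (simp add: mult.commute)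
  finally show ?thesis by (simp add: add_increasing2)
next
  case False
  have "\<bar>signed_pow p a\<bar> \<le> \<bar>b\<bar> powr (p-1)" using False assms by (simp add: abs_signed_pow powr_mono2)
  then have "\<bar>signed_pow p a\<bar> * \<bar>b\<bar> \<le> \<bar>b\<bar> powr (p-1) * \<bar>b\<bar>" by (intro mult_right_mono) auto
  also have "\<dots> = \<bar>b\<bar> powr p" using powr_mult_base[of "\<bar>b\<bar>" "p-1"] by (simp add: mult.commute)
  finally show ?thesis by (simp add: abs_mult add_increasing)
qed

lemma measurable_signed_pow [measurable]: "signed_pow p \<in> borel_measurable borel"
  unfolding signed_pow_def by measurable

lemma powr_add_le: 
  assumes "1 < p" "0 \<le> a" "0 \<le> (b::real)" shows "(a + b) powr p \<le> 2 powr p * (a powr p + b powr p)"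
proof -
  have "(a + b) powr p \<le> (2 * max a b) powr p" using assms by (intro powr_mono2) auto
  also have "\<dots> = 2 powr p * (max a b) powr p" using assms by (simp add: powr_mult)
  also have "\<dots> \<le> 2 powr p * (a powr p + b powr p)" by (intro mult_left_mono) (auto simp: max_def)
  finally show ?thesis .
qed

section \<open>Test functions\<close>

text \<open>
  A 1-Lipschitz function with values in \<open>[0, 1]\<close>, vanishing outside \<open>\<Omega>\<close> and, for open bounded \<open>\<Omega>\<close>,
  positive on all of \<open>\<Omega>\<close>. For \<open>\<Omega> = UNIV\<close> it degenerates to 0, since \<open>infdist x {} = 0\<close>.
\<close>

definition cutoff :: "'a::euclidean_space set \<Rightarrow> 'a \<Rightarrow> real"
  where "cutoff \<Omega> x = min 1 (infdist x (- \<Omega>))"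

lemma cutoff_bounds: "0 \<le> cutoff \<Omega> x" "cutoff \<Omega> x \<le> 1"
  by (auto simp: cutoff_def infdist_nonneg)

lemma cutoff_outside: "x \<notin> \<Omega> \<Longrightarrow> cutoff \<Omega> x = 0"
  by (simp add: cutoff_def)

lemma cutoff_pos:
  assumes "open \<Omega>" "bounded \<Omega>" "x \<in> \<Omega>"
  shows "0 < cutoff \<Omega> x"
proof -
  have "- \<Omega> \<noteq> {}" using assms(2) not_bounded_UNIV[where 'a='a] by (metis Compl_empty_eq double_compl)
  then have "0 < infdist x (- \<Omega>)"
    using assms by (intro infdist_pos_not_in_closed) (auto simp: closed_def)
  then show ?thesis by (simp add: cutoff_def)
qed

lemma cutoff_diff_le: "\<bar>cutoff \<Omega> x - cutoff \<Omega> y\<bar> \<le> min 1 (norm (x - y))"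
  using infdist_triangle_abs[of x "- \<Omega>" y] cutoff_bounds[of \<Omega> x] cutoff_bounds[of \<Omega> y]
  by (auto simp: cutoff_def dist_norm min_def split: if_splits)

lemma cutoff_measurable [measurable]: "cutoff \<Omega> \<in> borel_measurable borel"
  unfolding cutoff_def[abs_def]
  by (intro borel_measurable_continuous_onI continuous_intros)

lemma gagliardo_integrand_measurable [measurable]:
  assumes [measurable]: "u \<in> borel_measurable lebesgue"
  shows "gagliardo_integrand s p u \<in> borel_measurable (lebesgue \<Otimes>\<^sub>M lebesgue)"
  unfolding gagliardo_integrand_def case_prod_beta by measurable

lemma gagliardo_integrand_nonneg: "0 \<le> gagliardo_integrand s p u z"
  by (simp add: gagliardo_integrand_def case_prod_beta)

lemma Wsp_UNIV_iff:
  "u \<in> Wsp s p UNIV \<longleftrightarrow> u \<in> borel_measurable lebesgue \<and> integrable lebesgue (\<lambda>x. \<bar>u x\<bar> powr p)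
     \<and> integrable (lebesgue \<Otimes>\<^sub>M lebesgue) (gagliardo_integrand s p u)"
  by (auto simp: Wsp_def Lp_space_def set_integrable_def set_borel_measurable_def)

lemma integrable_bounded_support:
  assumes "\<Omega> \<in> lmeasurable" and [measurable]: "f \<in> borel_measurable lebesgue"
    and "\<And>x. \<bar>f x\<bar> \<le> C" "\<And>x. x \<notin> \<Omega> \<Longrightarrow> f x = (0::real)"
  shows "integrable lebesgue f"
proof (rule Bochner_Integration.integrable_bound)
  show "integrable lebesgue (\<lambda>x. C * indicator \<Omega> x)"
    using assms(1) by (intro integrable_mult_right) (simp add: lmeasurable_iff_integrable)
  show "AE x in lebesgue. norm (f x) \<le> norm (C * indicator \<Omega> x)"
    using assms(3,4) by (intro AE_I2) (auto simp: indicator_def intro: order_trans[OF _ abs_ge_self])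
qed simp

text \<open>
  The Gagliardo integrand vanishes unless \<open>x\<close> or \<open>y\<close> lies in \<open>\<Omega>\<close>, and is bounded by an integrable
  function of \<open>x - y\<close>; integrating first over the free variable leaves a multiple of the measure of \<open>\<Omega>\<close>.
\<close>

lemma cutoff_in_Wsp:
  fixes \<Omega> :: "(real^'n) set"
  assumes s: "0 < s" "s < 1" and p: "1 < p" and \<Omega>: "open \<Omega>" "bounded \<Omega>"
  shows "cutoff \<Omega> \<in> Wsp s p UNIV"
proof -
  let ?L = "lebesgue :: (real^'n) measure"
  let ?d = "real CARD('n) + s * p"
  have [measurable]: "cutoff \<Omega> \<in> borel_measurable ?L"
    by (rule measurable_lebesgue_of_borel) simp
  have lm: "\<Omega> \<in> lmeasurable" using \<Omega> by (simp add: bounded_set_imp_lmeasurable)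
  then have [measurable]: "\<Omega> \<in> sets ?L" by auto
  define K where "K h = ennreal (min 1 (norm h) powr p / norm h powr ?d)" for h :: "real^'n"
  have Kb [measurable]: "K \<in> borel_measurable borel" unfolding K_def by measurable
  have Ksym: "K (x - y) = K (y - x)" for x y by (simp add: K_def norm_minus_commute)
  have Kfin: "integral\<^sup>N lborel K < \<infinity>"
  proof -
    have "K = (\<lambda>h. ennreal (min (norm h powr (p - s*p)) (norm h powr (-(s*p))) / norm h powr real DIM(real^'n)))"
      unfolding K_def using s p by (subst min_one_powr_over_kernel_eq) auto
    then show ?thesis
      using nn_integral_truncated_singular_kernel_finite[of "p - s*p" "s*p", where 'a="real^'n"] s p by simp
  qed
  have Kx: "(\<integral>\<^sup>+y. K (x - y) \<partial>?L) = integral\<^sup>N lborel K" for x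
    using nn_integral_lebesgue_translate[OF Kb, of "-x"] by (simp add: Ksym[of x])
  have fin: "emeasure ?L \<Omega> < \<infinity>" using lm by (simp add: fmeasurable_def)
  have "(\<integral>\<^sup>+z. K (fst z - snd z) * indicator \<Omega> (fst z) \<partial>(?L \<Otimes>\<^sub>M ?L)) = (\<integral>\<^sup>+x. \<integral>\<^sup>+y. K (x - y) * indicator \<Omega> x \<partial>?L \<partial>?L)"
    by (subst lebesgue.nn_integral_fst[symmetric]) auto
  also have "\<dots> = (\<integral>\<^sup>+x. integral\<^sup>N lborel K * indicator \<Omega> x \<partial>?L)"
    by (intro nn_integral_cong) (simp add: nn_integral_multc Kx)
  also have "\<dots> < \<infinity>" using Kfin fin by (simp add: nn_integral_cmult_indicator ennreal_mult_less_top)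
  finally have 1: "(\<integral>\<^sup>+z. K (fst z - snd z) * indicator \<Omega> (fst z) \<partial>(?L \<Otimes>\<^sub>M ?L)) < \<infinity>" .
  have "(\<integral>\<^sup>+z. K (fst z - snd z) * indicator \<Omega> (snd z) \<partial>(?L \<Otimes>\<^sub>M ?L)) = (\<integral>\<^sup>+y. \<integral>\<^sup>+x. K (x - y) * indicator \<Omega> y \<partial>?L \<partial>?L)"
    by (subst lebesgue_pair.nn_integral_snd[symmetric]) auto
  also have "\<dots> = (\<integral>\<^sup>+x. integral\<^sup>N lborel K * indicator \<Omega> x \<partial>?L)"
    by (intro nn_integral_cong) (simp add: nn_integral_multc Kx Ksym)
  also have "\<dots> < \<infinity>" using Kfin fin by (simp add: nn_integral_cmult_indicator ennreal_mult_less_top)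
  finally have 2: "(\<integral>\<^sup>+z. K (fst z - snd z) * indicator \<Omega> (snd z) \<partial>(?L \<Otimes>\<^sub>M ?L)) < \<infinity>" .
  have "integrable (?L \<Otimes>\<^sub>M ?L) (gagliardo_integrand s p (cutoff \<Omega>))"
  proof (rule integrableI_bounded)
    have "ennreal (norm (gagliardo_integrand s p (cutoff \<Omega>) z))
        \<le> K (fst z - snd z) * indicator \<Omega> (fst z) + K (fst z - snd z) * indicator \<Omega> (snd z)" for z
    proof (cases "fst z \<in> \<Omega> \<or> snd z \<in> \<Omega>")
      case True
      have "gagliardo_integrand s p (cutoff \<Omega>) z \<le> min 1 (norm (fst z - snd z)) powr p / norm (fst z - snd z) powr ?d"
        unfolding gagliardo_integrand_def case_prod_beta
        using p by (intro divide_right_mono powr_mono2 cutoff_diff_le) auto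
      then have "ennreal (norm (gagliardo_integrand s p (cutoff \<Omega>) z)) \<le> K (fst z - snd z)"
        unfolding K_def by (intro ennreal_leI) (simp add: gagliardo_integrand_nonneg)
      then show ?thesis using True by (auto simp: indicator_def intro: order_trans)
    next
      case False
      then show ?thesis by (simp add: gagliardo_integrand_def case_prod_beta cutoff_outside)
    qed
    then have "(\<integral>\<^sup>+z. ennreal (norm (gagliardo_integrand s p (cutoff \<Omega>) z)) \<partial>(?L \<Otimes>\<^sub>M ?L))
      \<le> (\<integral>\<^sup>+z. K (fst z - snd z) * indicator \<Omega> (fst z) + K (fst z - snd z) * indicator \<Omega> (snd z) \<partial>(?L \<Otimes>\<^sub>M ?L))"
      by (intro nn_integral_mono)
    also have "\<dots> < \<infinity>" using 1 2 by (subst nn_integral_add) auto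
    finally show "(\<integral>\<^sup>+z. ennreal (norm (gagliardo_integrand s p (cutoff \<Omega>) z)) \<partial>(?L \<Otimes>\<^sub>M ?L)) < \<infinity>" .
  qed simp
  moreover have "integrable ?L (\<lambda>x. \<bar>cutoff \<Omega> x\<bar> powr p)"
    using cutoff_bounds[of \<Omega>] p
    by (intro integrable_bounded_support[OF lm, where C = 1]) (auto simp: cutoff_outside intro: powr_le1)
  ultimately show ?thesis by (simp add: Wsp_UNIV_iff)
qed

lemma cutoff_mult_Lipschitz_in_Wsp_tilde:
  fixes \<Omega> :: "(real^'n) set"
  assumes p: "1 < p" and \<Omega>: "open \<Omega>" "bounded \<Omega>"
    and w: "w \<in> Wsp s p UNIV" and \<phi>: "\<phi> \<in> Wsp s p UNIV"
    and \<phi>01: "\<And>x. 0 \<le> \<phi> x" "\<And>x. \<phi> x \<le> 1" and \<phi>0: "\<And>x. x \<notin> \<Omega> \<Longrightarrow> \<phi> x = 0"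
    and g [measurable]: "g \<in> borel_measurable borel" and g01: "\<And>t. 0 \<le> g t" "\<And>t. g t \<le> 1"
    and gL: "\<And>a b. \<bar>g a - g b\<bar> \<le> c * \<bar>a - b\<bar>"
  shows "(\<lambda>x. \<phi> x * g (w x)) \<in> Wsp s p UNIV" "(\<lambda>x. \<phi> x * g (w x)) \<in> Wsp_tilde s p \<Omega>"
proof -
  define v where "v x = \<phi> x * g (w x)" for x
  have [measurable]: "w \<in> borel_measurable lebesgue" "\<phi> \<in> borel_measurable lebesgue"
    using w \<phi> by (auto simp: Wsp_UNIV_iff)
  have v [measurable]: "v \<in> borel_measurable lebesgue" unfolding v_def by measurable
  have c: "0 \<le> c" using gL[of 1 0] by (auto intro: order_trans[OF abs_ge_zero])
  have lm: "\<Omega> \<in> lmeasurable" using \<Omega> by (simp add: bounded_set_imp_lmeasurable)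
  have [measurable]: "\<Omega> \<in> sets lebesgue" using lm by auto
  have v01: "0 \<le> v x" "v x \<le> 1" "x \<notin> \<Omega> \<Longrightarrow> v x = 0" for x
    using \<phi>01[of x] g01[of "w x"] \<phi>0[of x] by (auto simp: v_def mult_le_one)
  have Lp: "integrable lebesgue (\<lambda>x. \<bar>v x\<bar> powr p)"
    using p v01 by (intro integrable_bounded_support[OF lm, where C = 1]) (auto intro: powr_le1)
  have G: "integrable (lebesgue \<Otimes>\<^sub>M lebesgue) (gagliardo_integrand s p v)"
  proof (rule Bochner_Integration.integrable_bound)
    show "integrable (lebesgue \<Otimes>\<^sub>M lebesgue)
       (\<lambda>z. 2 powr p * (gagliardo_integrand s p \<phi> z + c powr p * gagliardo_integrand s p w z))"
      using w \<phi> by (intro integrable_mult_right Bochner_Integration.integrable_add) (auto simp: Wsp_UNIV_iff)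
    have "gagliardo_integrand s p v (x, y)
      \<le> 2 powr p * (gagliardo_integrand s p \<phi> (x, y) + c powr p * gagliardo_integrand s p w (x, y))" for x y
    proof -
      have "v x - v y = (\<phi> x - \<phi> y) * g (w x) + \<phi> y * (g (w x) - g (w y))" by (simp add: v_def algebra_simps)
      then have "\<bar>v x - v y\<bar> \<le> \<bar>\<phi> x - \<phi> y\<bar> * g (w x) + \<phi> y * \<bar>g (w x) - g (w y)\<bar>"
        using abs_triangle_ineq[of "(\<phi> x - \<phi> y) * g (w x)" "\<phi> y * (g (w x) - g (w y))"] g01[of "w x"] \<phi>01[of y]
        by (simp add: abs_mult)
      also have "\<dots> \<le> \<bar>\<phi> x - \<phi> y\<bar> * 1 + 1 * (c * \<bar>w x - w y\<bar>)"
        using g01 \<phi>01 gL by (intro add_mono mult_mono) auto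
      finally have "\<bar>v x - v y\<bar> powr p \<le> (\<bar>\<phi> x - \<phi> y\<bar> + c * \<bar>w x - w y\<bar>) powr p"
        using p by (intro powr_mono2) auto
      also have "\<dots> \<le> 2 powr p * (\<bar>\<phi> x - \<phi> y\<bar> powr p + (c * \<bar>w x - w y\<bar>) powr p)"
        using p c by (intro powr_add_le) auto
      also have "(c * \<bar>w x - w y\<bar>) powr p = c powr p * \<bar>w x - w y\<bar> powr p"
        using c by (simp add: powr_mult)
      finally show ?thesis
        by (auto simp: gagliardo_integrand_def add_divide_distrib[symmetric] intro: divide_right_mono)
    qed
    then show "AE z in lebesgue \<Otimes>\<^sub>M lebesgue. norm (gagliardo_integrand s p v z)
       \<le> norm (2 powr p * (gagliardo_integrand s p \<phi> z + c powr p * gagliardo_integrand s p w z))"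
      by (intro AE_I2) (auto simp: gagliardo_integrand_nonneg intro: order_trans[OF _ abs_ge_self])
  qed simp
  have vW: "v \<in> Wsp s p UNIV" using Lp G by (simp add: Wsp_UNIV_iff)
  moreover have "zero_ext \<Omega> v = v" using v01 by (auto simp: zero_ext_def)
  moreover have "v \<in> Wsp s p \<Omega>"
  proof -
    have "set_borel_measurable lebesgue \<Omega> v" by (simp add: set_borel_measurable_def)
    moreover have "set_integrable lebesgue \<Omega> (\<lambda>x. \<bar>v x\<bar> powr p)"
      unfolding set_integrable_def using Lp by (intro integrable_mult_indicator) auto
    moreover have "set_integrable (lebesgue \<Otimes>\<^sub>M lebesgue) (\<Omega> \<times> \<Omega>) (gagliardo_integrand s p v)"
      unfolding set_integrable_def using G by (intro integrable_mult_indicator) auto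
    ultimately show ?thesis by (simp add: Wsp_def Lp_space_def)
  qed
  ultimately show "(\<lambda>x. \<phi> x * g (w x)) \<in> Wsp s p UNIV" "(\<lambda>x. \<phi> x * g (w x)) \<in> Wsp_tilde s p \<Omega>"
    by (auto simp: Wsp_tilde_def v_def[abs_def])
qed

text \<open>
  The profiles \<open>g\<^sub>k\<close>: Lipschitz, decreasing, equal to 1 on the nonpositive half-line and to 0 from
  \<open>1 / (k + 1)\<close> on. As \<open>k\<close> grows they decrease to the indicator function of that half-line.
\<close>

definition zero_profile :: "nat \<Rightarrow> real \<Rightarrow> real"
  where "zero_profile k t = max 0 (1 - real (Suc k) * max 0 t)"

lemma zero_profile_bounds: "0 \<le> zero_profile k t" "zero_profile k t \<le> 1"
  by (auto simp: zero_profile_def)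

lemma zero_profile_measurable [measurable]: "zero_profile k \<in> borel_measurable borel"
  unfolding zero_profile_def by measurable

lemma zero_profile_antimono: "a \<le> b \<Longrightarrow> zero_profile k b \<le> zero_profile k a"
  unfolding zero_profile_def by (intro max.mono diff_mono mult_left_mono) auto

lemma zero_profile_Lipschitz: "\<bar>zero_profile k a - zero_profile k b\<bar> \<le> real (Suc k) * \<bar>a - b\<bar>"
proof -
  have "\<bar>zero_profile k a - zero_profile k b\<bar> \<le> \<bar>real (Suc k) * max 0 a - real (Suc k) * max 0 b\<bar>"
    by (auto simp: zero_profile_def max_def)
  also have "\<dots> = real (Suc k) * \<bar>max 0 a - max 0 b\<bar>"
    by (simp only: right_diff_distrib[symmetric] abs_mult abs_of_nat)
  also have "\<dots> \<le> real (Suc k) * \<bar>a - b\<bar>" by (intro mult_left_mono) auto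
  finally show ?thesis .
qed

lemma zero_profile_zero: "zero_profile k 0 = 1"
  by (simp add: zero_profile_def)

lemma zero_profile_eq_0: "m \<le> k \<Longrightarrow> 1 / real (Suc m) \<le> t \<Longrightarrow> zero_profile k t = 0"
proof -
  assume mk: "m \<le> k" and t: "1 / real (Suc m) \<le> t"
  have "0 < t" using t by (rule less_le_trans[rotated]) simp
  have "1 \<le> real (Suc m) * t" using t by (simp add: field_simps)
  also have "\<dots> \<le> real (Suc k) * t" using mk \<open>0 < t\<close> by (intro mult_right_mono) auto
  finally show ?thesis using \<open>0 < t\<close> by (simp add: zero_profile_def)
qed

lemma zero_profile_eventually_0:
  assumes "0 < t" shows "eventually (\<lambda>k. zero_profile k t = 0) sequentially"
proof -
  obtain m where "1 / real (Suc m) < t" using nat_approx_posE[OF assms] by (auto simp: inverse_eq_divide)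
  then show ?thesis unfolding eventually_sequentially
    using zero_profile_eq_0 by (intro exI[of _ m]) auto
qed

section \<open>The limit in the equation\<close>

lemma signed_pow_0 [simp]: "signed_pow p 0 = 0" by (simp add: signed_pow_def)

text \<open>
  The weight \<open>W\<close> stands for the potential or for the indicator function of \<open>\<Omega>\<close>. No integrability
  of \<open>w\<close> is needed, as \<open>w \<le> 1\<close> wherever the test function does not vanish.
\<close>

lemma lower_order_term_tendsto_0:
  fixes w \<phi> W :: "'a::euclidean_space \<Rightarrow> real"
  assumes p: "1 < p" and W: "integrable lebesgue W"
    and [measurable]: "w \<in> borel_measurable lebesgue" "\<phi> \<in> borel_measurable lebesgue"
    and \<phi>01: "\<And>x. 0 \<le> \<phi> x" "\<And>x. \<phi> x \<le> 1" and w0: "AE x in lebesgue. 0 \<le> w x"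
  shows "(\<lambda>k. \<integral>x. W x * (signed_pow p (w x) * (\<phi> x * zero_profile k (w x))) \<partial>lebesgue) \<longlonglongrightarrow> 0"
proof -
  have [measurable]: "W \<in> borel_measurable lebesgue" using W by auto
  have "(\<lambda>k. \<integral>x. W x * (signed_pow p (w x) * (\<phi> x * zero_profile k (w x))) \<partial>lebesgue)
      \<longlonglongrightarrow> (\<integral>x. 0 \<partial>(lebesgue :: 'a measure))"
  proof (rule integral_dominated_convergence[where w = "\<lambda>x. \<bar>W x\<bar>"])
    show "AE x in lebesgue. (\<lambda>k. W x * (signed_pow p (w x) * (\<phi> x * zero_profile k (w x)))) \<longlonglongrightarrow> 0"
      using w0
    proof eventually_elim
      case (elim x)
      show ?case
      proof (cases "w x = 0")
        case False
        then have "eventually (\<lambda>k. zero_profile k (w x) = 0) sequentially"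
          using elim by (intro zero_profile_eventually_0) auto
        then have "eventually (\<lambda>k. W x * (signed_pow p (w x) * (\<phi> x * zero_profile k (w x))) = 0) sequentially"
          by eventually_elim simp
        then show ?thesis by (rule tendsto_eventually)
      qed simp
    qed
    fix k
    show "AE x in lebesgue. norm (W x * (signed_pow p (w x) * (\<phi> x * zero_profile k (w x)))) \<le> \<bar>W x\<bar>"
      using w0
    proof eventually_elim
      case (elim x)
      have "\<bar>signed_pow p (w x)\<bar> * (\<phi> x * zero_profile k (w x)) \<le> 1"
      proof (cases "w x \<le> 1")
        case True
        have "\<bar>signed_pow p (w x)\<bar> \<le> 1" using True elim p by (simp add: abs_signed_pow powr_le1)
        moreover have "\<phi> x * zero_profile k (w x) \<le> 1"
          using \<phi>01[of x] zero_profile_bounds[of k "w x"] by (intro mult_le_one) auto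
        ultimately show ?thesis
          using \<phi>01[of x] zero_profile_bounds[of k "w x"] by (intro mult_le_one) auto
      next
        case False
        then show ?thesis using zero_profile_eq_0[of 0 k "w x"] by simp
      qed
      then have "\<bar>W x\<bar> * (\<bar>signed_pow p (w x)\<bar> * (\<phi> x * zero_profile k (w x))) \<le> \<bar>W x\<bar> * 1"
        by (intro mult_left_mono) auto
      then show ?case using \<phi>01[of x] zero_profile_bounds[of k "w x"] by (simp add: abs_mult)
    qed
  qed (use W in auto)
  then show ?thesis by simp
qed

text \<open>
  If the form tends to 0 along the test functions concentrating on the zero set of \<open>w\<close>, then there is
  no interaction between the zeros of \<open>w\<close> with \<open>\<phi> > 0\<close> and the points where \<open>w\<close> is positive.
\<close>

lemma AE_no_pair_of_zero_and_positive_point: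
  fixes w \<phi> :: "real^'n \<Rightarrow> real"
  assumes p: "1 < p" and w: "w \<in> Wsp s p UNIV" and \<phi>: "\<phi> \<in> Wsp s p UNIV"
    and \<phi>0: "\<And>x. 0 \<le> \<phi> x" and w0: "AE x in lebesgue. 0 \<le> w x"
    and v: "\<And>k. (\<lambda>x. \<phi> x * zero_profile k (w x)) \<in> Wsp s p UNIV"
    and lim: "(\<lambda>k. frac_form s p w (\<lambda>x. \<phi> x * zero_profile k (w x))) \<longlonglongrightarrow> 0"
  shows "AE z in lebesgue \<Otimes>\<^sub>M lebesgue. \<not> (0 < \<phi> (fst z) \<and> w (fst z) = 0 \<and> 0 < w (snd z))"
proof -
  let ?M = "lebesgue \<Otimes>\<^sub>M lebesgue :: ((real^'n) \<times> (real^'n)) measure"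
  have [measurable]: "w \<in> borel_measurable lebesgue" "\<phi> \<in> borel_measurable lebesgue"
    using w \<phi> by (auto simp: Wsp_UNIV_iff)
  define v where "v k x = \<phi> x * zero_profile k (w x)" for k x
  have [measurable]: "v k \<in> borel_measurable lebesgue" for k unfolding v_def by measurable
  have vW: "v k \<in> Wsp s p UNIV" for k using v by (simp add: v_def[abs_def])
  define N where "N z = norm (fst z - snd z) powr (real CARD('n) + s * p)" for z :: "(real^'n) \<times> (real^'n)"
  have N0: "0 \<le> N z" for z by (simp add: N_def)
  have [measurable]: "N \<in> borel_measurable ?M" unfolding N_def by measurable
  define J where "J z = signed_pow p (w (fst z) - w (snd z))" for z
  have [measurable]: "J \<in> borel_measurable ?M" unfolding J_def by measurable
  define I where "I k z = J z * (v k (fst z) - v k (snd z)) / N z" for k z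
  define B where "B k z = J z * (\<phi> (fst z) - \<phi> (snd z)) * zero_profile k (max (w (fst z)) (w (snd z))) / N z" for k z
  have [measurable]: "I k \<in> borel_measurable ?M" "B k \<in> borel_measurable ?M" for k
    unfolding I_def B_def by measurable
  have gi: "gagliardo_integrand s p f z = \<bar>f (fst z) - f (snd z)\<bar> powr p / N z" for f z
    by (simp add: gagliardo_integrand_def case_prod_beta N_def)
  have young: "\<bar>J z * (f (fst z) - f (snd z)) / N z\<bar> \<le> gagliardo_integrand s p w z + gagliardo_integrand s p f z" for f z
    unfolding gi add_divide_distrib[symmetric] abs_divide J_def
    using N0[of z] signed_pow_mult_le[OF p] by (simp add: divide_right_mono)
  have gint: "integrable ?M (\<lambda>z. gagliardo_integrand s p w z + gagliardo_integrand s p f z)"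
    if "f \<in> Wsp s p UNIV" for f
    using that w by (auto simp: Wsp_UNIV_iff)
  have Iint: "integrable ?M (I k)" for k
  proof (rule Bochner_Integration.integrable_bound[OF gint[OF vW[of k]]])
    show "AE z in ?M. norm (I k z) \<le> norm (gagliardo_integrand s p w z + gagliardo_integrand s p (v k) z)"
      using young by (intro AE_I2) (auto simp: I_def intro: order_trans[OF _ abs_ge_self])
  qed simp
  have Bbd: "\<bar>B k z\<bar> \<le> gagliardo_integrand s p w z + gagliardo_integrand s p \<phi> z" for k z
  proof -
    let ?c = "zero_profile k (max (w (fst z)) (w (snd z)))"
    have "\<bar>B k z\<bar> = \<bar>J z * (\<phi> (fst z) - \<phi> (snd z)) / N z\<bar> * ?c"
      using zero_profile_bounds(1) by (simp add: B_def abs_mult)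
    also have "\<dots> \<le> \<bar>J z * (\<phi> (fst z) - \<phi> (snd z)) / N z\<bar>"
      using zero_profile_bounds by (intro mult_left_le) auto
    finally show ?thesis using young[of z \<phi>] by linarith
  qed
  have Bint: "integrable ?M (B k)" for k
  proof (rule Bochner_Integration.integrable_bound[OF gint[OF \<phi>]])
    show "AE z in ?M. norm (B k z) \<le> norm (gagliardo_integrand s p w z + gagliardo_integrand s p \<phi> z)"
      using Bbd by (intro AE_I2) (auto intro: order_trans[OF _ abs_ge_self])
  qed simp
  \<comment> \<open>If the larger of the two values of \<open>w\<close> is positive, \<open>B k\<close> vanishes for large \<open>k\<close>; if it is 0, so is \<open>J\<close>.\<close>
  have "(\<lambda>k. integral\<^sup>L ?M (B k)) \<longlonglongrightarrow> (\<integral>z. 0 \<partial>?M)"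
  proof (rule integral_dominated_convergence[OF _ _ gint[OF \<phi>]])
    show "AE z in ?M. (\<lambda>k. B k z) \<longlonglongrightarrow> 0"
      using AE_lebesgue_pair_fst_snd[OF w0]
    proof eventually_elim
      case (elim z)
      show ?case
      proof (cases "0 < max (w (fst z)) (w (snd z))")
        case True
        from zero_profile_eventually_0[OF this]
        have "eventually (\<lambda>k. B k z = 0) sequentially" by eventually_elim (simp add: B_def)
        then show ?thesis by (rule tendsto_eventually)
      next
        case False
        then have "w (fst z) = 0" "w (snd z) = 0" using elim by auto
        then show ?thesis by (simp add: B_def J_def)
      qed
    qed
    show "AE z in ?M. norm (B k z) \<le> gagliardo_integrand s p w z + gagliardo_integrand s p \<phi> z" for k
      using Bbd by simp
  qed auto
  then have Blim: "(\<lambda>k. integral\<^sup>L ?M (B k)) \<longlonglongrightarrow> 0" by simp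
  have "I k = (\<lambda>(x, y). signed_pow p (w x - w y) * (v k x - v k y) / norm (x - y) powr (real CARD('n) + s * p))" for k
    by (auto simp: fun_eq_iff I_def J_def N_def)
  then have "integral\<^sup>L ?M (I k) = 2 * frac_form s p w (v k)" for k
    by (simp add: frac_form_def)
  then have Ilim: "(\<lambda>k. integral\<^sup>L ?M (I k)) \<longlonglongrightarrow> 0"
    using tendsto_mult_left[OF lim, of 2] by (simp add: v_def[abs_def])
  have A: "I k z - B k z = J z * ((if w (fst z) \<le> w (snd z) then \<phi> (fst z) else \<phi> (snd z))
      * (zero_profile k (w (fst z)) - zero_profile k (w (snd z)))) / N z" for k z
  proof -
    let ?a = "(if w (fst z) \<le> w (snd z) then \<phi> (fst z) else \<phi> (snd z))
      * (zero_profile k (w (fst z)) - zero_profile k (w (snd z)))"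
    let ?b = "(\<phi> (fst z) - \<phi> (snd z)) * zero_profile k (max (w (fst z)) (w (snd z)))"
    have "v k (fst z) - v k (snd z) = ?a + ?b"
      by (cases "w (fst z) \<le> w (snd z)") (simp_all add: v_def max_def left_diff_distrib right_diff_distrib)
    then have "I k z = J z * (?a + ?b) / N z" by (simp only: I_def)
    moreover have "B k z = J z * ?b / N z" by (simp only: B_def mult.assoc)
    ultimately show ?thesis by (simp only: distrib_left add_divide_distrib add_diff_cancel_right')
  qed
  \<comment> \<open>\<open>t \<mapsto> |t|\<^sup>p\<^sup>-\<^sup>2 t\<close> preserves signs and the profile is decreasing.\<close>
  have Aneg: "I k z - B k z \<le> 0" for k z
  proof (cases "w (fst z) \<le> w (snd z)")
    case True
    then have "J z \<le> 0" by (simp add: J_def signed_pow_def mult_nonneg_nonpos)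
    moreover have "0 \<le> \<phi> (fst z) * (zero_profile k (w (fst z)) - zero_profile k (w (snd z)))"
      using \<phi>0 zero_profile_antimono[OF True] by simp
    ultimately show ?thesis
      unfolding A using True N0 by (simp add: mult_nonpos_nonneg divide_nonpos_nonneg)
  next
    case False
    then have "0 \<le> J z" by (simp add: J_def signed_pow_def)
    moreover have "\<phi> (snd z) * (zero_profile k (w (fst z)) - zero_profile k (w (snd z))) \<le> 0"
      using \<phi>0 False by (intro mult_nonneg_nonpos) (auto intro: zero_profile_antimono)
    ultimately show ?thesis
      unfolding A using False N0 by (simp add: mult_nonneg_nonpos divide_nonpos_nonneg)
  qed
  \<comment> \<open>On the set in the condition, \<open>I k - B k\<close> is the same function for all \<open>k \<ge> m\<close>, namely \<open>- F m\<close>.\<close>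
  define F where "F m z = (if w (fst z) = 0 \<and> 1 / real (Suc m) < w (snd z)
      then w (snd z) powr (p - 1) * \<phi> (fst z) / N z else 0)" for m z
  have [measurable]: "F m \<in> borel_measurable ?M" for m unfolding F_def by measurable
  have F0: "0 \<le> F m z" for m z using \<phi>0 N0 by (simp add: F_def)
  have FA: "F m z \<le> B k z - I k z" if "m \<le> k" for m k z
  proof (cases "w (fst z) = 0 \<and> 1 / real (Suc m) < w (snd z)")
    case True
    then have "0 < w (snd z)" by (auto intro: less_trans[rotated])
    have "zero_profile k (w (snd z)) = 0" using True that by (intro zero_profile_eq_0[of m]) auto
    moreover have "J z = - (w (snd z) powr (p - 1))"
      using True \<open>0 < w (snd z)\<close> powr_mult_base[of "w (snd z)" "p-2"] by (simp add: J_def signed_pow_def mult.commute)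
    ultimately have "I k z - B k z = - F m z"
      unfolding A using True \<open>0 < w (snd z)\<close> by (simp add: F_def zero_profile_zero)
    then show ?thesis by simp
  next
    case False
    then have "F m z = 0" by (auto simp: F_def)
    then show ?thesis using Aneg[of k z] by simp
  qed
  have "AE z in ?M. F m z = 0" for m
  proof -
    have Fint: "integrable ?M (F m)"
    proof (rule Bochner_Integration.integrable_bound)
      show "integrable ?M (\<lambda>z. B m z - I m z)" using Iint Bint by simp
      show "AE z in ?M. norm (F m z) \<le> norm (B m z - I m z)"
        using FA[of m m] F0 by (intro AE_I2) (auto intro: order_trans[OF _ abs_ge_self])
    qed simp
    have "integral\<^sup>L ?M (F m) \<le> integral\<^sup>L ?M (B k) - integral\<^sup>L ?M (I k)" if "m \<le> k" for k
    proof -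
      have "integral\<^sup>L ?M (F m) \<le> (\<integral>z. B k z - I k z \<partial>?M)"
        using Fint Iint Bint FA[OF that] by (intro integral_mono) auto
      then show ?thesis using Iint Bint by simp
    qed
    then have "integral\<^sup>L ?M (F m) \<le> 0 - 0"
      by (intro LIMSEQ_le_const[OF tendsto_diff[OF Blim Ilim]]) auto
    moreover have "0 \<le> integral\<^sup>L ?M (F m)" using F0 by simp
    ultimately have "integral\<^sup>L ?M (F m) = 0" by simp
    then show ?thesis using integral_nonneg_eq_0_iff_AE[OF Fint] F0 by simp
  qed
  then have "AE z in ?M. \<forall>m. F m z = 0" by (simp add: AE_all_countable)
  then show ?thesis
  proof eventually_elim
    case (elim z)
    show ?case
    proof
      assume *: "0 < \<phi> (fst z) \<and> w (fst z) = 0 \<and> 0 < w (snd z)"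
      obtain m where m: "1 / real (Suc m) < w (snd z)"
        using * nat_approx_posE[of "w (snd z)"] by (auto simp: inverse_eq_divide)
      have "fst z \<noteq> snd z" using * by auto
      then have "0 < N z" by (simp add: N_def)
      then have "0 < F m z" using * m by (simp add: F_def)
      then show False using elim by simp
    qed
  qed
qed

section \<open>Positivity of nonnegative eigenfunctions\<close>

theorem lemma3p1:
  fixes \<Omega> :: "(real^'n) set" and V u :: "real^'n \<Rightarrow> real" and s p q ev :: real
  assumes "0 < s" "s < 1" "1 < p"
    and "bounded \<Omega>" "extension_domain s p \<Omega>"
    and "1 < q" "real CARD('n) / (s * p) < q" "V \<in> Lp_space q \<Omega>"
    and "eigenvalue s p \<Omega> V ev" "eigenfunction s p \<Omega> V ev u"
    and "AE x in lebesgue. x \<in> \<Omega> \<longrightarrow> 0 \<le> u x"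
  shows "AE x in lebesgue. x \<in> \<Omega> \<longrightarrow> 0 < u x"
proof -
  let ?L = "lebesgue :: (real^'n) measure"
  have op: "open \<Omega>" using assms(5) by (simp add: extension_domain_def)
  have lm: "\<Omega> \<in> lmeasurable" using op assms(4) by (simp add: bounded_set_imp_lmeasurable)
  have [measurable]: "\<Omega> \<in> sets ?L" using lm by auto
  define w where "w = zero_ext \<Omega> u"
  define \<phi> where "\<phi> = cutoff \<Omega>"
  define v where "v k x = \<phi> x * zero_profile k (w x)" for k x
  note ef = assms(10)[unfolded eigenfunction_def]
  have w: "w \<in> Wsp s p UNIV" using ef by (simp add: Wsp_tilde_def w_def)
  have \<phi>: "\<phi> \<in> Wsp s p UNIV" unfolding \<phi>_def using assms(1-4) op by (intro cutoff_in_Wsp)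
  have [measurable]: "w \<in> borel_measurable ?L" "\<phi> \<in> borel_measurable ?L"
    using w \<phi> by (auto simp: Wsp_UNIV_iff)
  have w0: "AE x in ?L. 0 \<le> w x" using assms(11) by eventually_elim (simp add: w_def zero_ext_def)
  have \<phi>01: "0 \<le> \<phi> x" "\<phi> x \<le> 1" for x by (auto simp: \<phi>_def cutoff_bounds)
  have \<phi>out: "\<phi> x = 0" if "x \<notin> \<Omega>" for x using that by (simp add: \<phi>_def cutoff_outside)
  have v: "v k \<in> Wsp s p UNIV" "v k \<in> Wsp_tilde s p \<Omega>" for k
    using cutoff_mult_Lipschitz_in_Wsp_tilde[OF assms(3) op assms(4) w \<phi> \<phi>01 \<phi>out
        zero_profile_measurable zero_profile_bounds zero_profile_Lipschitz, of k]
    by (auto simp: v_def[abs_def])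
  have vz: "zero_ext \<Omega> (v k) = v k" for k using \<phi>out by (auto simp: zero_ext_def v_def)
  have Vm: "(\<lambda>x. indicator \<Omega> x * V x) \<in> borel_measurable ?L"
    and Vq: "integrable ?L (\<lambda>x. indicator \<Omega> x * \<bar>V x\<bar> powr q)"
    using assms(8) by (auto simp: Lp_space_def set_borel_measurable_def set_integrable_def)
  have indi: "integrable ?L (indicator \<Omega> :: _ \<Rightarrow> real)" using lm by (simp add: lmeasurable_iff_integrable)
  have Vi: "integrable ?L (\<lambda>x. indicator \<Omega> x * V x)"
  proof (rule Bochner_Integration.integrable_bound[OF Bochner_Integration.integrable_add[OF indi Vq] Vm])
    have "\<bar>V x\<bar> \<le> 1 + \<bar>V x\<bar> powr q" for x
    proof (cases "\<bar>V x\<bar> \<le> 1")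
      case False
      then have "\<bar>V x\<bar> powr 1 \<le> \<bar>V x\<bar> powr q" using assms(6) by (intro powr_mono) auto
      then show ?thesis using False by simp
    qed (simp add: add_increasing2)
    then show "AE x in ?L. norm (indicator \<Omega> x * V x) \<le> norm (indicator \<Omega> x + indicator \<Omega> x * \<bar>V x\<bar> powr q)"
      by (intro AE_I2) (auto simp: indicator_def)
  qed
  have eq: "frac_form s p w (v k) = ev * (\<integral>x. indicator \<Omega> x * (signed_pow p (w x) * v k x) \<partial>?L)
      - (\<integral>x. indicator \<Omega> x * V x * (signed_pow p (w x) * v k x) \<partial>?L)" for k
  proof -
    have "frac_form s p w (v k) + set_lebesgue_integral lebesgue \<Omega> (\<lambda>x. V x * signed_pow p (u x) * v k x)
       = ev * integral\<^sup>L lebesgue (\<lambda>x. signed_pow p (w x) * v k x)"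
      using ef[THEN conjunct2, THEN conjunct2, THEN bspec, OF v(2)[of k]] by (simp only: vz w_def)
    moreover have "set_lebesgue_integral lebesgue \<Omega> (\<lambda>x. V x * signed_pow p (u x) * v k x)
       = (\<integral>x. indicator \<Omega> x * V x * (signed_pow p (w x) * v k x) \<partial>?L)"
      unfolding set_lebesgue_integral_def
      by (intro Bochner_Integration.integral_cong) (auto simp: w_def zero_ext_def indicator_def)
    moreover have "integral\<^sup>L ?L (\<lambda>x. signed_pow p (w x) * v k x)
       = (\<integral>x. indicator \<Omega> x * (signed_pow p (w x) * v k x) \<partial>?L)"
      using \<phi>out by (intro Bochner_Integration.integral_cong) (auto simp: v_def indicator_def)
    ultimately show ?thesis by simp
  qed
  have "(\<lambda>k. frac_form s p w (v k)) \<longlonglongrightarrow> ev * 0 - 0"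
    unfolding eq v_def using assms(3) indi Vi \<phi>01 w0
    by (intro tendsto_diff tendsto_mult_left lower_order_term_tendsto_0) auto
  then have "(\<lambda>k. frac_form s p w (\<lambda>x. \<phi> x * zero_profile k (w x))) \<longlonglongrightarrow> 0"
    by (simp add: v_def[abs_def])
  from AE_no_pair_of_zero_and_positive_point[OF assms(3) w \<phi> \<phi>01(1) w0 v(1)[unfolded v_def[abs_def]] this]
  have *: "AE z in ?L \<Otimes>\<^sub>M ?L. \<not> (0 < \<phi> (fst z) \<and> w (fst z) = 0 \<and> 0 < w (snd z))" .
  define Z where "Z = {x \<in> \<Omega>. w x = 0}"
  define P where "P = {x. 0 < w x}"
  have "{x \<in> space ?L. x \<in> \<Omega> \<and> w x = 0} \<in> sets ?L" "{x \<in> space ?L. 0 < w x} \<in> sets ?L"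
    by measurable
  then have [measurable]: "Z \<in> sets ?L" "P \<in> sets ?L"
    by (simp_all add: Z_def P_def)
  have "AE z in ?L \<Otimes>\<^sub>M ?L. z \<notin> Z \<times> P"
    using * by eventually_elim (use cutoff_pos[OF op assms(4)] in \<open>auto simp: Z_def P_def \<phi>_def\<close>)
  then have "Z \<times> P \<in> null_sets (?L \<Otimes>\<^sub>M ?L)" by (subst AE_iff_null_sets) auto
  then have "emeasure (?L \<Otimes>\<^sub>M ?L) (Z \<times> P) = 0" by (rule null_setsD1)
  then have "emeasure ?L Z * emeasure ?L P = 0"
    by (simp only: lebesgue.emeasure_pair_measure_Times[OF \<open>Z \<in> sets ?L\<close> \<open>P \<in> sets ?L\<close>])
  moreover have "P \<notin> null_sets ?L"
  proof
    assume "P \<in> null_sets ?L"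
    then have "AE x in ?L. x \<notin> P" by (rule AE_not_in)
    then have "AE x in ?L. x \<in> \<Omega> \<longrightarrow> u x = 0"
      using w0 by eventually_elim (auto simp: P_def w_def zero_ext_def)
    then show False using ef by simp
  qed
  ultimately have "Z \<in> null_sets ?L" by (auto simp: null_sets_def)
  then have "AE x in ?L. x \<notin> Z" by (rule AE_not_in)
  then show ?thesis
    using assms(11) by eventually_elim (auto simp: Z_def w_def zero_ext_def)
qed

end
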